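(* Let $1\le p<\infty$ and $\mathbf{w}\in\mathcal{W}$. For each $\varepsilon>0$ there is a sublattice $Z\subseteq g(\mathbf{w},p)$ that is $(1+\varepsilon)$-lattice complemented in $g(\mathbf{w},p)$ and $(1+\varepsilon)$-lattice isomorphic to $\left(\bigoplus_{n=1}^\infty \ell_\infty^n\right)_p$.
   Context: Scalars are in $\mathbb{F}=\mathbb{R}$ or $\mathbb{C}$. $\mathcal{W}$ denotes the set of weights $\mathbf{w}=(w_j)_{j=1}^\infty\in c_0\setminus\ell_1$ with $1=w_1\ge w_2\ge\cdots\ge w_j\ge w_{j+1}\ge\cdots>0$. Let $\mathcal{O}$ be the set of all (strictly) increasing functions from $\mathbb{N}=\{1,2,\dots\}$ to $\mathbb{N}$. For $1\le p<\infty$ and $\mathbf{w}\in\mathcal{W}$, the Garling sequence space $g(\mathbf{w},p)$ is the Banach space of all scalar sequences $f=(a_j)_{j=1}^\infty$ such that $$\|f\|_{g(\mathbf{w},p)}=\sup_{\phi\in\mathcal{O}}\left(\sum_{j=1}^\infty |a_{\phi(j)}|^p w_j\right)^{1/p}<\infty.$$ $\left(\bigoplus_{n=1}^\infty \ell_\infty^n\right)_p$ is the direct sum in the $\ell_p$ sense of the spaces $\ell_\infty^n=(\mathbb{F}^n,\|\cdot\|_\infty)$, i.e. the space of all $f=((a_{i,n})_{i=1}^n)_{n=1}^\infty$ with $\|f\|=\left(\sum_{n=1}^\infty(\max_{1\le i\le n}|a_{i,n}|)^p\right)^{1/p}<\infty$. Both spaces are (real or complex) Banach lattices with the coordinatewise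 order and modulus. A sublattice is a closed linear subspace closed under the coordinatewise modulus (and under coordinatewise complex conjugation in the complex case). $Z$ is $C$-lattice complemented in $X$ if there is a positive linear projection from $X$ onto $Z$ of norm at most $C$. Two Banach lattices are $C$-lattice isomorphic if there is a bounded linear bijection $T$ between them, with bounded inverse, such that $|Tf|=T|f|$ for all $f$ and $\|T\|\,\|T^{-1}\|\le C$. *)

theory Defs
  imports Complex_Main
begin

text \<open>
  The scalar field is $\mathbb{R}$ or $\mathbb{C}$. Both are instances of the class below, and
  by \<open>real_or_complex_cases\<close> it has no other members up to isometric isomorphism.
\<close>

class real_or_complex = real_normed_field +
  fixes scalar_conj :: "'a \<Rightarrow> 'a"
  assumes scalar_conj_add: "scalar_conj (x + y) = scalar_conj x + scalar_conj y"
    and mult_scalar_conj_scaleR: "x * scalar_conj x = ((norm x)\<^sup>2) *\<^sub>R 1"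

lemma mult_scalar_conj:
  "x * scalar_conj x = of_real ((norm x)\<^sup>2)" for x :: "'a::real_or_complex"
  by (simp only: mult_scalar_conj_scaleR of_real_def)

instantiation real :: real_or_complex
begin
definition scalar_conj_real :: "real \<Rightarrow> real" where "scalar_conj_real x = x"
instance
  by standard (simp_all add: scalar_conj_real_def power2_eq_square)
end

instantiation complex :: real_or_complex
begin
definition scalar_conj_complex :: "complex \<Rightarrow> complex" where "scalar_conj_complex = cnj"
instance
  by standard (simp_all only: scalar_conj_complex_def complex_cnj_add complex_norm_square flip: of_real_def)
end

lemma scalar_conj_of_real:
  "scalar_conj (of_real r :: 'a::real_or_complex) = of_real r"
proof (cases "r = 0")
  case True
  then show ?thesis
    using scalar_conj_add[of "0::'a" 0] by simp
next
  case False
  have "of_real r * scalar_conj (of_real r :: 'a) = of_real r * of_real r"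
    using mult_scalar_conj[of "of_real r :: 'a"] by (simp add: power2_eq_square)
  then show ?thesis using False by simp
qed

lemma add_scalar_conj_Reals:
  fixes z :: "'a::real_or_complex"
  shows "z + scalar_conj z \<in> \<real>"
proof -
  have "scalar_conj (1 + z) = 1 + scalar_conj z"
    using scalar_conj_of_real[of 1, where 'a = 'a] by (simp add: scalar_conj_add)
  then have "(1 + z) * (1 + scalar_conj z) = of_real ((norm (1 + z))\<^sup>2)"
    using mult_scalar_conj[of "1 + z"] by simp
  then have "z + scalar_conj z = of_real ((norm (1 + z))\<^sup>2 - 1 - (norm z)\<^sup>2)"
    using mult_scalar_conj[of z] by (simp add: algebra_simps)
  then show ?thesis by (metis Reals_of_real)
qed

lemma real_plus_imaginary:
  fixes z :: "'a::real_or_complex"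
  obtains a y where "z = of_real a + y" "y * y = - of_real ((norm y)\<^sup>2)"
proof -
  obtain t where t: "z + scalar_conj z = of_real t"
    using add_scalar_conj_Reals[of z] by (auto elim: Reals_cases)
  define y where "y = z - of_real (t / 2)"
  have z: "z = of_real (t / 2) + y" by (simp add: y_def)
  have "scalar_conj z = of_real (t / 2) + scalar_conj y"
    by (subst z) (simp add: scalar_conj_add scalar_conj_of_real del: of_real_divide)
  moreover have "(of_real t :: 'a) = of_real (t / 2) + of_real (t / 2)"
    by (simp flip: of_real_add)
  ultimately have "y + scalar_conj y = 0"
    using t z by (metis (no_types, lifting) add.assoc add.commute add_left_imp_eq add_0_right)
  then have "scalar_conj y = - y"
    by (metis add.commute eq_neg_iff_add_eq_0)
  then have "y * y = - of_real ((norm y)\<^sup>2)"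
    using mult_scalar_conj[of y] by (metis minus_minus mult_minus_right)
  with z show thesis by (rule that)
qed

lemma real_or_complex_cases:
  "(UNIV :: 'a::real_or_complex set) = \<real> \<or>
   (\<exists>\<i>'::'a. \<i>' * \<i>' = -1 \<and> (\<forall>z. \<exists>a b. z = of_real a + of_real b * \<i>'))"
proof (cases "(UNIV :: 'a set) = \<real>")
  case False
  then obtain z :: 'a where z: "z \<notin> \<real>" by auto
  obtain a y where y: "z = of_real a + y" "y * y = - of_real ((norm y)\<^sup>2)"
    by (rule real_plus_imaginary)
  have "y \<noteq> 0" using y z by auto
  define j where "j = y / of_real (norm y)"
  have jj: "j * j = -1"
    using \<open>y \<noteq> 0\<close> y(2) by (simp add: j_def power2_eq_square)
  have "\<exists>a b. x = of_real a + of_real b * j" for x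
  proof -
    obtain c v where v: "x = of_real c + v" "v * v = - of_real ((norm v)\<^sup>2)"
      by (rule real_plus_imaginary)
    have "v * v = (of_real (norm v) * j) * (of_real (norm v) * j)"
      using v(2) jj by (simp add: power2_eq_square mult.assoc mult.left_commute)
    then have "v = of_real (norm v) * j \<or> v = of_real (- norm v) * j"
      by (simp add: square_eq_iff)
    then show ?thesis using v(1) by metis
  qed
  with jj show ?thesis by blast
qed simp


subsection \<open>Lattices of scalar families\<close>

text \<open>
  A Banach lattice of scalar families is given by its carrier \<open>E\<close>, a set of functions
  \<open>'i \<Rightarrow> 'a\<close>, and its norm \<open>N\<close>, which is meaningful only on \<open>E\<close>. Vector operations, order,
  modulus and conjugation are coordinatewise.
\<close>

definition modulus :: "('i \<Rightarrow> 'a::real_or_complex) \<Rightarrow> 'i \<Rightarrow> 'a" where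
  "modulus f = (\<lambda>i. of_real (norm (f i)))"

definition nonneg :: "('i \<Rightarrow> 'a::real_or_complex) \<Rightarrow> bool" where
  "nonneg f \<longleftrightarrow> (\<forall>i. \<exists>r\<ge>0. f i = of_real r)"

definition linear_subspace ::
    "('i \<Rightarrow> 'a::real_or_complex) set \<Rightarrow> ('i \<Rightarrow> 'a) set \<Rightarrow> bool" where
  "linear_subspace Z E \<longleftrightarrow> Z \<subseteq> E \<and> (\<lambda>i. 0) \<in> Z \<and>
     (\<forall>f\<in>Z. \<forall>g\<in>Z. (\<lambda>i. f i + g i) \<in> Z) \<and> (\<forall>c. \<forall>f\<in>Z. (\<lambda>i. c * f i) \<in> Z)"

definition norm_closed ::
    "('i \<Rightarrow> 'a::real_or_complex) set \<Rightarrow> ('i \<Rightarrow> 'a) set \<Rightarrow> (('i \<Rightarrow> 'a) \<Rightarrow> real) \<Rightarrow> bool" where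
  "norm_closed Z E N \<longleftrightarrow>
     (\<forall>g f. (\<forall>k. g k \<in> Z) \<and> f \<in> E \<and> (\<lambda>k::nat. N (\<lambda>i. g k i - f i)) \<longlonglongrightarrow> 0 \<longrightarrow> f \<in> Z)"

definition sublattice ::
    "('i \<Rightarrow> 'a::real_or_complex) set \<Rightarrow> ('i \<Rightarrow> 'a) set \<Rightarrow> (('i \<Rightarrow> 'a) \<Rightarrow> real) \<Rightarrow> bool" where
  "sublattice Z E N \<longleftrightarrow> linear_subspace Z E \<and> norm_closed Z E N \<and>
     (\<forall>f\<in>Z. modulus f \<in> Z) \<and> (\<forall>f\<in>Z. (\<lambda>i. scalar_conj (f i)) \<in> Z)"

definition linear_map_on ::
    "('i \<Rightarrow> 'a::real_or_complex) set \<Rightarrow> (('i \<Rightarrow> 'a) \<Rightarrow> ('k \<Rightarrow> 'a)) \<Rightarrow> bool" where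
  "linear_map_on E T \<longleftrightarrow>
     (\<forall>f\<in>E. \<forall>g\<in>E. T (\<lambda>i. f i + g i) = (\<lambda>k. T f k + T g k)) \<and>
     (\<forall>c. \<forall>f\<in>E. T (\<lambda>i. c * f i) = (\<lambda>k. c * T f k))"

definition bounded_map_on ::
    "'v set \<Rightarrow> ('v \<Rightarrow> real) \<Rightarrow> ('u \<Rightarrow> real) \<Rightarrow> ('v \<Rightarrow> 'u) \<Rightarrow> bool" where
  "bounded_map_on E N M T \<longleftrightarrow> (\<exists>K. \<forall>f\<in>E. M (T f) \<le> K * N f)"

text \<open>
  The quotient at \<open>f = 0\<close> is \<open>0\<close>, as in \<open>onorm\<close>. The supremum is the operator norm
  provided that \<open>bounded_map_on\<close> holds.
\<close>

definition op_norm ::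
    "'v set \<Rightarrow> ('v \<Rightarrow> real) \<Rightarrow> ('u \<Rightarrow> real) \<Rightarrow> ('v \<Rightarrow> 'u) \<Rightarrow> real" where
  "op_norm E N M T = (SUP f\<in>E. M (T f) / N f)"

definition lattice_complemented ::
    "real \<Rightarrow> ('i \<Rightarrow> 'a::real_or_complex) set \<Rightarrow> ('i \<Rightarrow> 'a) set \<Rightarrow> (('i \<Rightarrow> 'a) \<Rightarrow> real) \<Rightarrow> bool" where
  "lattice_complemented C Z E N \<longleftrightarrow>
     (\<exists>P. linear_map_on E P \<and> P ` E = Z \<and> (\<forall>f\<in>E. P (P f) = P f) \<and>
          (\<forall>f\<in>E. nonneg f \<longrightarrow> nonneg (P f)) \<and>
          bounded_map_on E N N P \<and> op_norm E N N P \<le> C)"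

definition lattice_isomorphic ::
    "real \<Rightarrow> ('i \<Rightarrow> 'a::real_or_complex) set \<Rightarrow> (('i \<Rightarrow> 'a) \<Rightarrow> real) \<Rightarrow>
     ('k \<Rightarrow> 'a) set \<Rightarrow> (('k \<Rightarrow> 'a) \<Rightarrow> real) \<Rightarrow> bool" where
  "lattice_isomorphic C E N F M \<longleftrightarrow>
     (\<exists>T. linear_map_on E T \<and> bij_betw T E F \<and> (\<forall>f\<in>E. modulus (T f) = T (modulus f)) \<and>
          bounded_map_on E N M T \<and> bounded_map_on F M N (inv_into E T) \<and>
          op_norm E N M T * op_norm F M N (inv_into E T) \<le> C)"


subsection \<open>Garling sequence spaces\<close>

text \<open>Sequences are indexed from \<open>0\<close>; so \<open>w 0\<close> is the first weight.\<close>

definition weights :: "(nat \<Rightarrow> real) set" where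
  "weights = {w. w \<longlonglongrightarrow> 0 \<and> \<not> summable w \<and> w 0 = 1 \<and> decseq w \<and> (\<forall>j. w j > 0)}"

definition garling_space :: "(nat \<Rightarrow> real) \<Rightarrow> real \<Rightarrow> (nat \<Rightarrow> 'a::real_or_complex) set" where
  "garling_space w p = {f.
     (\<forall>\<phi>::nat \<Rightarrow> nat. strict_mono \<phi> \<longrightarrow> summable (\<lambda>j. norm (f (\<phi> j)) powr p * w j)) \<and>
     bdd_above ((\<lambda>\<phi>. (\<Sum>j. norm (f (\<phi> j)) powr p * w j) powr (1 / p)) `
       {\<phi>::nat \<Rightarrow> nat. strict_mono \<phi>})}"

definition garling_norm :: "(nat \<Rightarrow> real) \<Rightarrow> real \<Rightarrow> (nat \<Rightarrow> 'a::real_or_complex) \<Rightarrow> real" where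
  "garling_norm w p f =
     (SUP \<phi>\<in>{\<phi>::nat \<Rightarrow> nat. strict_mono \<phi>}. (\<Sum>j. norm (f (\<phi> j)) powr p * w j) powr (1 / p))"


subsection \<open>The \<open>\<ell>\<^sub>p\<close>-sum of the spaces \<open>\<ell>\<^sub>\<infinity>\<^sup>n\<close>\<close>

text \<open>
  With indices starting at \<open>0\<close>, block \<open>n\<close> has the \<open>n + 1\<close> coordinates \<open>(i, n)\<close>, \<open>i \<le> n\<close>.
  Triangular arrays are represented by functions on all pairs that vanish off the triangle.
\<close>

definition block_norm :: "(nat \<times> nat \<Rightarrow> 'a::real_or_complex) \<Rightarrow> nat \<Rightarrow> real" where
  "block_norm f n = (MAX i\<in>{..n}. norm (f (i, n)))"

definition lp_sum_linf_space :: "real \<Rightarrow> (nat \<times> nat \<Rightarrow> 'a::real_or_complex) set" where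
  "lp_sum_linf_space p =
     {f. (\<forall>i n. n < i \<longrightarrow> f (i, n) = 0) \<and> summable (\<lambda>n. block_norm f n powr p)}"

definition lp_sum_linf_norm :: "real \<Rightarrow> (nat \<times> nat \<Rightarrow> 'a::real_or_complex) \<Rightarrow> real" where
  "lp_sum_linf_norm p f = (\<Sum>n. block_norm f n powr p) powr (1 / p)"

end

theory Submission
  imports Defs "HOL-Analysis.Convex" "HOL-Analysis.Elementary_Normed_Spaces"
    "HOL-Library.Nat_Bijection"
begin

text \<open>
  Write \<open>W k\<close> for the sum of the first \<open>k\<close> weights. The copy of the direct sum is spanned by
  normalized indicators of disjoint intervals of \<open>\<nat>\<close>, one interval \<open>intv (i, n)\<close> for each coordinate
  \<open>(i, n)\<close>, and everything depends on the order and the lengths of these intervals.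

  Within block \<open>n\<close> the intervals are placed on the line by decreasing length, each one far longer
  than the next. Let a subsequence select many terms of a long interval before it enters a shorter
  one. Then the weights left for the shorter one are tiny, because \<open>w\<close> tends to \<open>0\<close>. If it selects
  few, then it has collected only a negligible part of the norm of the long interval, because \<open>W\<close>
  is unbounded. So at most one interval of the block contributes substantially
  (\<open>block_weight_le\<close>), and the block spans a space almost isometric to \<open>\<ell>\<^sub>\<infinity>\<close> of dimension \<open>n + 1\<close>.

  The blocks follow each other, and every interval of a block is so long that discarding an
  initial piece of the weights, of the length of all preceding blocks, hardly changes the total
  weight it can receive. Restricting a subsequence to one block only increases the weights, which
  gives the upper \<open>p\<close>-estimate over the blocks; selecting the best interval of each block gives the
  lower one. Normalizing the indicator of \<open>intv q\<close> by the mass \<open>mass q\<close> of the shifted weights makes the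
  lower estimate exact, so that the factor \<open>1 + \<epsilon>\<close> enters in the upper estimate only
  (\<open>synthesis_bounded\<close>).

  The coordinates of a function are recovered by averages over the intervals, taken not uniformly
  but with respect to the shifted weights. By Jensen's inequality, the \<open>p\<close>-th power of such an average
  times the mass is at most the weighted sum of \<open>p\<close>-th powers over the interval, and a subsequence
  running through one interval of each block sees at least all these sums. Hence the map
  \<open>analysis\<close> that collects these averages has norm at most \<open>1\<close> (\<open>analysis_contractive\<close>).
  It is a left inverse of the map \<open>synthesis\<close> that spreads out the coordinates over the
  intervals, and \<open>factorization_sublattice\<close> turns the two maps into the sublattice, the projection and the isomorphism.
\<close>

section \<open>Conjugation and powers\<close>

text \<open>
  The axioms give only additivity and the value of \<open>z * scalar_conj z\<close>; since a field has no zero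
  divisors, the latter determines the conjugate of a nonzero scalar.
\<close>

lemma scalar_conj_of_real_mult:
  fixes z :: "'a::real_or_complex"
  shows "scalar_conj (of_real r * z) = of_real r * scalar_conj z"
proof (cases "r = 0 \<or> z = 0")
  case True
  then show ?thesis
    using scalar_conj_of_real[of 0, where 'a = 'a] by auto
next
  case False
  have "(of_real r * z) * scalar_conj (of_real r * z) = (of_real r * z) * (of_real r * scalar_conj z)"
  proof -
    have "(of_real r * z) * scalar_conj (of_real r * z) = of_real (r\<^sup>2) * of_real ((norm z)\<^sup>2)"
      by (simp add: mult_scalar_conj norm_mult power_mult_distrib)
    also have "\<dots> = (of_real r * of_real r) * (z * scalar_conj z)"
      by (simp add: mult_scalar_conj power2_eq_square)
    finally show ?thesis by (simp add: mult_ac)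
  qed
  then show ?thesis using False by simp
qed

lemma norm_scalar_conj [simp]:
  fixes z :: "'a::real_or_complex"
  shows "norm (scalar_conj z) = norm z"
proof (cases "z = 0")
  case True
  then show ?thesis
    using scalar_conj_of_real[of 0, where 'a = 'a] by simp
next
  case False
  have "norm z * norm (scalar_conj z) = norm z * norm z"
    by (metis mult_scalar_conj norm_mult norm_of_real abs_of_nonneg zero_le_power2 power2_eq_square)
  then show ?thesis using False by simp
qed

lemma powr_add_le:
  fixes x y p :: real
  assumes "0 \<le> x" "0 \<le> y" "0 \<le> p"
  shows "(x + y) powr p \<le> 2 powr p * (x powr p + y powr p)"
proof -
  have "(x + y) powr p \<le> (2 * max x y) powr p" using assms by (intro powr_mono2) auto
  also have "\<dots> = 2 powr p * max x y powr p" using assms by (simp add: powr_mult)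
  also have "max x y powr p \<le> x powr p + y powr p" by (auto simp: max_def)
  finally show ?thesis by simp
qed

text \<open>
  Jensen's inequality for \<open>t \<mapsto> t powr p\<close>. The values may vanish, so convexity is needed up to the
  end point \<open>0\<close> of the half-line, where it amounts to \<open>v powr p \<le> v\<close> for \<open>v\<close> in \<open>[0, 1]\<close>.
\<close>

lemma powr_convex_sum:
  fixes a y :: "'i \<Rightarrow> real"
  assumes "1 \<le> p" and "finite A" and "\<And>i. i \<in> A \<Longrightarrow> 0 \<le> a i" and "sum a A = 1"
    and "\<And>i. i \<in> A \<Longrightarrow> 0 \<le> y i"
  shows "(\<Sum>i\<in>A. a i * y i) powr p \<le> (\<Sum>i\<in>A. a i * y i powr p)"
proof -
  have zero: "(v * y) powr p \<le> v * y powr p" if "0 \<le> v" "v \<le> 1" "0 \<le> y" for v y :: real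
  proof (cases "v = 0")
    case False
    then have "v powr p \<le> v powr 1" using that assms(1) by (intro powr_mono') auto
    then have "v powr p \<le> v" using that by simp
    then show ?thesis using that by (simp add: powr_mult mult_right_mono)
  qed (use that in simp)
  have "convex_on {0..} (\<lambda>x::real. x powr p)"
  proof (rule convex_onI)
    fix t x y :: real
    assume t: "0 < t" "t < 1" and xy: "x \<in> {0..}" "y \<in> {0..}"
    show "((1 - t) *\<^sub>R x + t *\<^sub>R y) powr p \<le> (1 - t) * x powr p + t * y powr p"
    proof (cases "x = 0 \<or> y = 0")
      case True
      then show ?thesis using t xy zero[of t y] zero[of "1 - t" x] by auto
    next
      case False
      then show ?thesis
        using convex_onD[OF powr_convex[OF assms(1)], of t x y] t xy by auto
    qed
  qed simp
  moreover have "A \<noteq> {}" using assms(4) by auto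
  ultimately show ?thesis
    using convex_on_sum[OF assms(2), of "{0..}" "\<lambda>x. x powr p" a y] assms by auto
qed

section \<open>Complemented sublattices from factorizations of the identity\<close>

lemma op_norm_le:
  assumes "E \<noteq> {}" and "\<And>f. f \<in> E \<Longrightarrow> M (T f) \<le> K * N f"
    and "\<And>f. f \<in> E \<Longrightarrow> 0 \<le> N f" and "0 \<le> K"
  shows "op_norm E N M T \<le> K"
  unfolding op_norm_def
proof (rule cSUP_least)
  fix f assume f: "f \<in> E"
  show "M (T f) / N f \<le> K"
  proof (cases "N f = 0")
    case False
    then show ?thesis using assms(2,3)[OF f] by (simp add: divide_le_eq)
  qed (use assms in simp)
qed (fact assms)

lemma op_norm_nonneg:
  assumes "E \<noteq> {}" and "\<And>f. f \<in> E \<Longrightarrow> M (T f) \<le> K * N f"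
    and "\<And>f. f \<in> E \<Longrightarrow> 0 \<le> N f" and "\<And>f. f \<in> E \<Longrightarrow> 0 \<le> M (T f)" and "0 \<le> K"
  shows "0 \<le> op_norm E N M T"
proof -
  obtain f where f: "f \<in> E" using assms(1) by auto
  have "M (T g) / N g \<le> K" if "g \<in> E" for g
  proof (cases "N g = 0")
    case False
    then show ?thesis using assms(2,3)[OF that] by (simp add: divide_le_eq)
  qed (use assms in simp)
  then have "bdd_above ((\<lambda>f. M (T f) / N f) ` E)" by (auto intro!: bdd_aboveI2)
  then have "M (T f) / N f \<le> op_norm E N M T"
    unfolding op_norm_def by (rule cSUP_upper[OF f])
  moreover have "0 \<le> M (T f) / N f" using assms(3,4)[OF f] by simp
  ultimately show ?thesis by linarith
qed

text \<open>
  Demanding closure under all changes that preserve the modulus in every coordinate covers the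
  modulus and the conjugation at once.
\<close>

definition lattice_carrier :: "('i \<Rightarrow> 'a::real_or_complex) set \<Rightarrow> (('i \<Rightarrow> 'a) \<Rightarrow> real) \<Rightarrow> bool" where
  "lattice_carrier E N \<longleftrightarrow> linear_subspace E UNIV \<and> (\<forall>f\<in>E. 0 \<le> N f) \<and>
     (\<forall>f\<in>E. \<forall>g. (\<forall>i. norm (g i) = norm (f i)) \<longrightarrow> g \<in> E)"

text \<open>
  If the identity of \<open>F\<close> factors as \<open>R \<circ> S\<close> through \<open>E\<close>, then \<open>S \<circ> R\<close> is a projection onto the range of
  \<open>S\<close>, and \<open>R\<close> restricted to this range inverts \<open>S\<close>. The range is closed because it is the fixed
  space of a bounded projection; the evaluation bound \<open>eval\<close> turns norm convergence into
  pointwise convergence, where limits are unique.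
\<close>

lemma factorization_sublattice:
  fixes E :: "('i \<Rightarrow> 'a::real_or_complex) set" and F :: "('k \<Rightarrow> 'a) set"
  assumes E: "lattice_carrier E N" and F: "lattice_carrier F M"
    and eval: "\<And>f i. f \<in> E \<Longrightarrow> norm (f i) \<le> N f"
    and S: "linear_map_on F S" "\<And>x. x \<in> F \<Longrightarrow> S x \<in> E" "\<And>x. x \<in> F \<Longrightarrow> N (S x) \<le> c * M x"
    and Smod: "\<And>x. x \<in> F \<Longrightarrow> modulus (S x) = S (modulus x)"
    and Sconj: "\<And>x. x \<in> F \<Longrightarrow> (\<lambda>i. scalar_conj (S x i)) = S (\<lambda>k. scalar_conj (x k))"
    and R: "linear_map_on E R" "\<And>f. f \<in> E \<Longrightarrow> R f \<in> F" "\<And>f. f \<in> E \<Longrightarrow> M (R f) \<le> N f"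
    and RS: "\<And>x. x \<in> F \<Longrightarrow> R (S x) = x"
    and pos: "\<And>f. f \<in> E \<Longrightarrow> nonneg f \<Longrightarrow> nonneg (S (R f))"
    and c: "0 \<le> c"
  shows "sublattice (S ` F) E N \<and> lattice_complemented c (S ` F) E N \<and>
         lattice_isomorphic c (S ` F) N F M"
proof -
  let ?Z = "S ` F"
  have E0: "(\<lambda>i. 0) \<in> E" and F0: "(\<lambda>k. 0) \<in> F"
    using E F by (auto simp: lattice_carrier_def linear_subspace_def)
  have Eadd: "(\<lambda>i. f i + g i) \<in> E" and Emul: "(\<lambda>i. a * f i) \<in> E"
    if "f \<in> E" "g \<in> E" for f g a
    using that E by (auto simp: lattice_carrier_def linear_subspace_def)
  have Fadd: "(\<lambda>i. x i + y i) \<in> F" and Fmul: "(\<lambda>i. a * x i) \<in> F"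
    if "x \<in> F" "y \<in> F" for x y a
    using that F by (auto simp: lattice_carrier_def linear_subspace_def)
  have Nnn: "0 \<le> N f" if "f \<in> E" for f using that E by (auto simp: lattice_carrier_def)
  have Mnn: "0 \<le> M x" if "x \<in> F" for x using that F by (auto simp: lattice_carrier_def)
  have Fsolid: "y \<in> F" if "x \<in> F" "\<And>k. norm (y k) = norm (x k)" for x y
    using that F by (auto simp: lattice_carrier_def)
  have Fmod: "modulus x \<in> F" if "x \<in> F" for x
    using that by (rule Fsolid) (simp add: modulus_def)
  have Fconj: "(\<lambda>k. scalar_conj (x k)) \<in> F" if "x \<in> F" for x
    using that by (rule Fsolid) simp
  have ZE: "?Z \<subseteq> E" using S(2) by auto
  have Radd: "R (\<lambda>i. f i + g i) = (\<lambda>k. R f k + R g k)" and Rmul: "R (\<lambda>i. a * f i) = (\<lambda>k. a * R f k)"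
    if "f \<in> E" "g \<in> E" for f g a
    using that R(1) by (auto simp: linear_map_on_def)
  have Sadd: "S (\<lambda>i. f i + g i) = (\<lambda>k. S f k + S g k)" and Smul: "S (\<lambda>i. a * f i) = (\<lambda>k. a * S f k)"
    if "f \<in> F" "g \<in> F" for f g a
    using that S(1) by (auto simp: linear_map_on_def)
  define P where "P f = S (R f)" for f
  have PE: "P f \<in> ?Z" if "f \<in> E" for f using that R(2) by (auto simp: P_def)
  have PZ: "P g = g" if "g \<in> ?Z" for g using that RS by (auto simp: P_def)
  have Padd: "P (\<lambda>i. f i + g i) = (\<lambda>i. P f i + P g i)" if "f \<in> E" "g \<in> E" for f g
    using that R(2) by (simp add: P_def Radd Sadd)
  have Pmul: "P (\<lambda>i. a * f i) = (\<lambda>i. a * P f i)" if "f \<in> E" for f a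
    using that R(2)[OF that] by (simp add: P_def Rmul Smul)
  have PN: "N (P f) \<le> c * N f" if "f \<in> E" for f
    using S(3)[OF R(2)[OF that]] mult_left_mono[OF R(3)[OF that] c] by (simp add: P_def)
  have "linear_subspace ?Z E"
    unfolding linear_subspace_def
  proof (intro conjI ballI allI)
    have "S (\<lambda>k. 0 * 0) = (\<lambda>i. 0 * S (\<lambda>k. 0) i)" by (rule Smul[OF F0 F0])
    then show "(\<lambda>i. 0) \<in> ?Z" using F0 by (auto intro: rev_image_eqI)
  next
    fix f g a assume "f \<in> ?Z" "g \<in> ?Z"
    then obtain x y where xy: "f = S x" "g = S y" "x \<in> F" "y \<in> F" by auto
    show "(\<lambda>i. f i + g i) \<in> ?Z"
      by (rule image_eqI[of _ S "\<lambda>i. x i + y i"]) (simp_all add: xy Sadd Fadd)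
  next
    fix f a assume "f \<in> ?Z"
    then obtain x where x: "f = S x" "x \<in> F" by auto
    show "(\<lambda>i. a * f i) \<in> ?Z"
      by (rule image_eqI[of _ S "\<lambda>i. a * x i"]) (simp_all add: x Smul[OF x(2) x(2)] Fmul[OF x(2) x(2)])
  qed (use ZE in auto)
  moreover have "norm_closed ?Z E N"
    unfolding norm_closed_def
  proof (intro allI impI)
    fix g f assume A: "(\<forall>k. g k \<in> ?Z) \<and> f \<in> E \<and> (\<lambda>k::nat. N (\<lambda>i. g k i - f i)) \<longlonglongrightarrow> 0"
    define d where "d k = (\<lambda>i. g k i + (- 1) * f i)" for k
    have gE: "g k \<in> E" and fE: "f \<in> E" for k using A ZE by auto
    have mf: "(\<lambda>i. (- 1) * f i) \<in> E" by (rule Emul[OF fE fE])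
    have dE: "d k \<in> E" for k unfolding d_def by (rule Eadd[OF gE mf])
    have d0: "(\<lambda>k. N (d k)) \<longlonglongrightarrow> 0" using A by (simp add: d_def)
    have Pd: "P (d k) = (\<lambda>i. g k i + (- 1) * P f i)" for k
      using A by (simp only: d_def Padd[OF gE mf] Pmul[OF fE] PZ)
    have "P f i = f i" for i
    proof -
      have "(\<lambda>k. d k i) \<longlonglongrightarrow> 0"
        by (rule Lim_null_comparison[OF _ d0]) (auto intro: always_eventually eval[OF dE])
      then have 1: "(\<lambda>k. g k i) \<longlonglongrightarrow> f i" by (simp add: d_def LIM_zero_iff)
      have c0: "(\<lambda>k. c * N (d k)) \<longlonglongrightarrow> 0" using tendsto_mult_left[OF d0, of c] by simp
      have "norm (P (d k) i) \<le> c * N (d k)" for k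
        by (rule order_trans[OF eval[OF subsetD[OF ZE PE[OF dE]]] PN[OF dE]])
      then have "(\<lambda>k. P (d k) i) \<longlonglongrightarrow> 0"
        by (intro Lim_null_comparison[OF always_eventually c0] allI)
      then have 2: "(\<lambda>k. g k i) \<longlonglongrightarrow> P f i" by (simp add: Pd LIM_zero_iff)
      show ?thesis by (rule LIMSEQ_unique[OF 2 1])
    qed
    then have "P f = f" by auto
    then show "f \<in> ?Z" using PE[OF fE] by simp
  qed
  moreover have "modulus f \<in> ?Z" if "f \<in> ?Z" for f
    using that Smod Fmod by auto
  moreover have "(\<lambda>i. scalar_conj (f i)) \<in> ?Z" if "f \<in> ?Z" for f
    using that Sconj Fconj by auto
  ultimately have 1: "sublattice ?Z E N" by (simp add: sublattice_def)
  have 2: "lattice_complemented c ?Z E N"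
    unfolding lattice_complemented_def
  proof (intro exI[of _ P] conjI)
    show "linear_map_on E P" unfolding linear_map_on_def using Padd Pmul by blast
    show "P ` E = ?Z"
    proof
      show "?Z \<subseteq> P ` E"
      proof
        fix g assume g: "g \<in> ?Z"
        show "g \<in> P ` E" by (rule image_eqI[of _ P g]) (use g PZ ZE in auto)
      qed
    qed (use PE in blast)
    show "\<forall>f\<in>E. P (P f) = P f" using PE PZ by blast
    show "\<forall>f\<in>E. nonneg f \<longrightarrow> nonneg (P f)" using pos by (auto simp: P_def)
    show "bounded_map_on E N N P" unfolding bounded_map_on_def using PN by blast
    show "op_norm E N N P \<le> c" by (rule op_norm_le) (use E0 PN Nnn c in auto)
  qed
  have inv: "inv_into ?Z R x = S x" if "x \<in> F" for x
  proof (rule inv_into_f_eq)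
    show "inj_on R ?Z" by (rule inj_onI) (use RS in auto)
  qed (use that RS in auto)
  have 3: "lattice_isomorphic c ?Z N F M"
    unfolding lattice_isomorphic_def
  proof (intro exI[of _ R] conjI)
    show "linear_map_on ?Z R" using R(1) ZE by (auto simp: linear_map_on_def subset_iff)
    show "bij_betw R ?Z F"
      by (rule bij_betwI[where g = S]) (use RS in auto)
    show "\<forall>f\<in>?Z. modulus (R f) = R (modulus f)" using RS Smod Fmod by auto
    show "bounded_map_on ?Z N M R" unfolding bounded_map_on_def using R(3) ZE by (metis mult_1 subsetD)
    show "bounded_map_on F M N (inv_into ?Z R)" unfolding bounded_map_on_def using inv S(3) by auto
    have le1: "op_norm ?Z N M R \<le> 1" by (rule op_norm_le) (use F0 R(3) ZE Nnn in auto)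
    have lec: "op_norm F M N (inv_into ?Z R) \<le> c"
      by (rule op_norm_le) (use F0 S(3) Mnn c inv in auto)
    have "0 \<le> op_norm F M N (inv_into ?Z R)"
      by (rule op_norm_nonneg[where K = c]) (use F0 S Mnn c inv Nnn in auto)
    with le1 have "op_norm ?Z N M R * op_norm F M N (inv_into ?Z R) \<le> 1 * op_norm F M N (inv_into ?Z R)"
      by (rule mult_right_mono)
    then show "op_norm ?Z N M R * op_norm F M N (inv_into ?Z R) \<le> c" using lec by linarith
  qed
  show ?thesis using 1 2 3 by blast
qed

section \<open>Garling sequence spaces\<close>

lemma garling_memI:
  fixes f :: "nat \<Rightarrow> 'a::real_or_complex"
  assumes p: "1 \<le> p" and w: "w \<in> weights" and "0 \<le> B"
    and bd: "\<And>\<phi> n. strict_mono \<phi> \<Longrightarrow> (\<Sum>j<n. norm (f (\<phi> j)) powr p * w j) \<le> B"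
  shows "f \<in> garling_space w p \<and> garling_norm w p f \<le> B powr (1 / p)"
proof -
  have wp: "w j \<ge> 0" for j using w by (auto simp: weights_def less_imp_le)
  have s: "summable (\<lambda>j. norm (f (\<phi> j)) powr p * w j)" if "strict_mono \<phi>" for \<phi>
    by (rule summableI_nonneg_bounded[where x = B]) (use bd[OF that] wp in auto)
  have le: "(\<Sum>j. norm (f (\<phi> j)) powr p * w j) powr (1 / p) \<le> B powr (1 / p)" if "strict_mono \<phi>" for \<phi>
    using p wp by (intro powr_mono2 suminf_nonneg suminf_le_const s that bd) auto
  have "f \<in> garling_space w p"
    unfolding garling_space_def using s le by (auto intro!: bdd_aboveI2)
  moreover have "garling_norm w p f \<le> B powr (1 / p)"
    unfolding garling_norm_def
    by (rule cSUP_least) (use le strict_mono_id in auto)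
  ultimately show ?thesis by blast
qed

lemma garling_sum_le:
  fixes f :: "nat \<Rightarrow> 'a::real_or_complex"
  assumes p: "1 \<le> p" and w: "w \<in> weights" and f: "f \<in> garling_space w p" and phi: "strict_mono \<phi>"
  shows "(\<Sum>j<n. norm (f (\<phi> j)) powr p * w j) \<le> garling_norm w p f powr p"
proof -
  have wp: "w j \<ge> 0" for j using w by (auto simp: weights_def less_imp_le)
  let ?s = "\<Sum>j. norm (f (\<phi> j)) powr p * w j"
  have s: "summable (\<lambda>j. norm (f (\<phi> j)) powr p * w j)"
    using f phi by (simp add: garling_space_def)
  have s0: "0 \<le> ?s" using s wp by (intro suminf_nonneg) auto
  have "?s powr (1 / p) \<le> garling_norm w p f"
    unfolding garling_norm_def using f phi by (intro cSUP_upper) (auto simp: garling_space_def)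
  then have "(?s powr (1 / p)) powr p \<le> garling_norm w p f powr p"
    using p by (intro powr_mono2) auto
  then have "?s \<le> garling_norm w p f powr p" using p s0 by (simp add: powr_powr)
  moreover have "(\<Sum>j<n. norm (f (\<phi> j)) powr p * w j) \<le> ?s"
    using s wp by (intro sum_le_suminf) auto
  ultimately show ?thesis by simp
qed

lemma garling_norm_nonneg:
  fixes f :: "nat \<Rightarrow> 'a::real_or_complex"
  assumes f: "f \<in> garling_space w p"
  shows "0 \<le> garling_norm w p f"
proof -
  have "(\<Sum>j. norm (f (id j)) powr p * w j) powr (1 / p) \<le> garling_norm w p f"
    unfolding garling_norm_def using f strict_mono_id
    by (intro cSUP_upper) (auto simp: garling_space_def id_def)
  then show ?thesis by (meson order_trans powr_ge_zero)
qed

text \<open>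
  Lower bounds for the norm come from selecting a finite set \<open>B\<close>: an element then meets the weight
  whose index is its rank in \<open>B\<close>, and a larger index only makes the weight smaller.
\<close>

lemma garling_rank_sum_le:
  fixes f :: "nat \<Rightarrow> 'a::real_or_complex"
  assumes p: "1 \<le> p" and w: "w \<in> weights" and f: "f \<in> garling_space w p" and B: "finite B"
    and rank: "\<And>k. k \<in> B \<Longrightarrow> card {x\<in>B. x < k} \<le> r k"
  shows "(\<Sum>k\<in>B. norm (f k) powr p * w (r k)) \<le> garling_norm w p f powr p"
proof -
  have wp: "w j \<ge> 0" for j using w by (auto simp: weights_def less_imp_le)
  have dec: "decseq w" using w by (auto simp: weights_def)
  \<comment> \<open>A subsequence is infinite, so \<open>B\<close> is continued beyond its maximum; this leaves the
    ranks of its elements unchanged.\<close>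
  define S where "S = B \<union> {Suc (Max B)..}"
  have inf: "infinite S" unfolding S_def by (simp add: infinite_Ici)
  define \<phi> where "\<phi> = enumerate S"
  have phi: "strict_mono \<phi>" unfolding \<phi>_def by (rule strict_mono_enumerate[OF inf])
  have rng: "range \<phi> = S" unfolding \<phi>_def by (rule range_enumerate[OF inf])
  define J where "J = {j. \<phi> j \<in> B}"
  have inj: "inj \<phi>" using phi by (rule strict_mono_imp_inj_on)
  have J: "finite J" using finite_vimageI[OF B inj] by (simp add: J_def vimage_def)
  have JB: "bij_betw \<phi> J B"
    unfolding bij_betw_def
  proof
    show "\<phi> ` J = B" using rng by (auto simp: J_def S_def)
  qed (use inj in \<open>auto intro: inj_on_subset\<close>)
  have rk: "j \<le> r (\<phi> j)" if "j \<in> J" for j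
  proof -
    have b: "\<phi> j \<in> B" using that by (simp add: J_def)
    have "\<phi> ` {..<j} \<subseteq> {x\<in>B. x < \<phi> j}"
    proof
      fix x assume "x \<in> \<phi> ` {..<j}"
      then have x: "x \<in> S" "x < \<phi> j" using rng phi by (auto simp: strict_mono_less)
      moreover have "\<phi> j \<le> Max B" using b B by simp
      ultimately show "x \<in> {x\<in>B. x < \<phi> j}" by (auto simp: S_def)
    qed
    then have "card (\<phi> ` {..<j}) \<le> card {x\<in>B. x < \<phi> j}" using B by (intro card_mono) auto
    moreover have "card (\<phi> ` {..<j}) = j" using inj by (simp add: card_image inj_on_subset)
    ultimately show ?thesis using rank[OF b] by simp
  qed
  have "(\<Sum>k\<in>B. norm (f k) powr p * w (r k)) = (\<Sum>j\<in>J. norm (f (\<phi> j)) powr p * w (r (\<phi> j)))"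
    by (rule sum.reindex_bij_betw[OF JB, symmetric])
  also have "\<dots> \<le> (\<Sum>j\<in>J. norm (f (\<phi> j)) powr p * w j)"
    using rk dec by (intro sum_mono mult_left_mono) (auto simp: decseq_def)
  also have "\<dots> \<le> (\<Sum>j<Suc (Max J). norm (f (\<phi> j)) powr p * w j)"
    using J wp by (intro sum_mono2) (auto simp: less_Suc_eq_le)
  also have "\<dots> \<le> garling_norm w p f powr p" by (rule garling_sum_le[OF p w f phi])
  finally show ?thesis .
qed

lemma lattice_carrier_garling:
  assumes p: "1 \<le> p" and w: "w \<in> weights"
  shows "lattice_carrier (garling_space w p :: (nat \<Rightarrow> 'a::real_or_complex) set) (garling_norm w p)"
  unfolding lattice_carrier_def linear_subspace_def
proof (intro conjI ballI allI impI)
  have wp: "w j \<ge> 0" for j using w by (auto simp: weights_def less_imp_le)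
  let ?N = "garling_norm w p"
  show "(\<lambda>i. 0) \<in> (garling_space w p :: (nat \<Rightarrow> 'a) set)"
    by (rule garling_memI[OF p w, THEN conjunct1, of 0]) auto
  fix f g :: "nat \<Rightarrow> 'a" and c :: 'a
  assume f: "f \<in> garling_space w p"
  show "0 \<le> ?N f" by (rule garling_norm_nonneg[OF f])
  show "(\<lambda>i. c * f i) \<in> garling_space w p"
  proof (rule garling_memI[OF p w, THEN conjunct1, of "norm c powr p * ?N f powr p"])
    fix \<phi> :: "nat \<Rightarrow> nat" and n assume phi: "strict_mono \<phi>"
    have "(\<Sum>j<n. norm (c * f (\<phi> j)) powr p * w j) = norm c powr p * (\<Sum>j<n. norm (f (\<phi> j)) powr p * w j)"
      by (simp add: norm_mult powr_mult sum_distrib_left mult.assoc)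
    also have "\<dots> \<le> norm c powr p * ?N f powr p"
      by (intro mult_left_mono garling_sum_le p w f phi) auto
    finally show "(\<Sum>j<n. norm (c * f (\<phi> j)) powr p * w j) \<le> \<dots>" .
  qed auto
  show "g \<in> garling_space w p" if "\<forall>i. norm (g i) = norm (f i)"
    by (rule garling_memI[OF p w, THEN conjunct1, of "?N f powr p"])
      (use that garling_sum_le[OF p w f] in auto)
  assume g: "g \<in> garling_space w p"
  show "(\<lambda>i. f i + g i) \<in> garling_space w p"
  proof (rule garling_memI[OF p w, THEN conjunct1, of "2 powr p * (?N f powr p + ?N g powr p)"])
    fix \<phi> :: "nat \<Rightarrow> nat" and n assume phi: "strict_mono \<phi>"
    have "norm (f k + g k) powr p \<le> 2 powr p * (norm (f k) powr p + norm (g k) powr p)" for k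
      using powr_mono2[OF _ _ norm_triangle_ineq[of "f k" "g k"], of p]
        powr_add_le[of "norm (f k)" "norm (g k)" p] p by auto
    then have "(\<Sum>j<n. norm (f (\<phi> j) + g (\<phi> j)) powr p * w j) \<le>
        (\<Sum>j<n. (2 powr p * (norm (f (\<phi> j)) powr p + norm (g (\<phi> j)) powr p)) * w j)"
      using wp by (intro sum_mono mult_right_mono) auto
    also have "\<dots> = 2 powr p * ((\<Sum>j<n. norm (f (\<phi> j)) powr p * w j) + (\<Sum>j<n. norm (g (\<phi> j)) powr p * w j))"
      by (simp add: sum_distrib_left sum.distrib algebra_simps)
    also have "\<dots> \<le> 2 powr p * (?N f powr p + ?N g powr p)"
      by (intro mult_left_mono add_mono garling_sum_le p w f g phi) auto
    finally show "(\<Sum>j<n. norm (f (\<phi> j) + g (\<phi> j)) powr p * w j) \<le> \<dots>" .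
  qed auto
qed auto

text \<open>
  The subsequence starting at \<open>i\<close> puts the weight \<open>w 0 = 1\<close> on the coordinate \<open>i\<close>.
\<close>

lemma norm_le_garling_norm:
  fixes f :: "nat \<Rightarrow> 'a::real_or_complex"
  assumes p: "1 \<le> p" and w: "w \<in> weights" and f: "f \<in> garling_space w p"
  shows "norm (f i) \<le> garling_norm w p f"
proof -
  have "strict_mono (\<lambda>j. i + j)" by (simp add: strict_mono_def)
  from garling_sum_le[OF p w f this, of 1] have "norm (f i) powr p \<le> garling_norm w p f powr p"
    using w by (simp add: weights_def)
  then show ?thesis
    using powr_less_mono2[of p "garling_norm w p f" "norm (f i)"] p garling_norm_nonneg[OF f]
    by force
qed


section \<open>The target space\<close>

lemma norm_le_block_norm: "i \<le> n \<Longrightarrow> norm (x (i, n)) \<le> block_norm x n"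
  unfolding block_norm_def by (rule Max_ge) auto

lemma block_norm_leI: "(\<And>i. i \<le> n \<Longrightarrow> norm (x (i, n)) \<le> B) \<Longrightarrow> block_norm x n \<le> B"
  unfolding block_norm_def by (rule Max.boundedI) auto

lemma block_norm_attained: "\<exists>i\<le>n. block_norm x n = norm (x (i, n))"
proof -
  have "block_norm x n \<in> (\<lambda>i. norm (x (i, n))) ` {..n}"
    unfolding block_norm_def by (rule Max_in) auto
  then show ?thesis by auto
qed

lemma block_norm_nonneg [simp]: "0 \<le> block_norm x n"
  by (rule order_trans[OF norm_ge_zero norm_le_block_norm[of 0 n x]]) simp

lemma lattice_carrier_lp_sum:
  assumes p: "1 \<le> p"
  shows "lattice_carrier (lp_sum_linf_space p :: (nat \<times> nat \<Rightarrow> 'a::real_or_complex) set) (lp_sum_linf_norm p)"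
  unfolding lattice_carrier_def linear_subspace_def
proof (intro conjI ballI allI impI)
  have b0: "block_norm (\<lambda>i. 0 :: 'a) n = 0" for n
    by (rule antisym) (auto intro: block_norm_leI)
  show "(\<lambda>i. 0) \<in> (lp_sum_linf_space p :: (nat \<times> nat \<Rightarrow> 'a) set)"
    by (simp add: lp_sum_linf_space_def b0)
  fix x y :: "nat \<times> nat \<Rightarrow> 'a" and c :: 'a
  assume x: "x \<in> lp_sum_linf_space p"
  then have sx: "summable (\<lambda>n. block_norm x n powr p)" by (simp add: lp_sum_linf_space_def)
  show "0 \<le> lp_sum_linf_norm p x" by (simp add: lp_sum_linf_norm_def)
  have "block_norm (\<lambda>i. c * x i) n \<le> norm c * block_norm x n" for n
    by (rule block_norm_leI) (auto simp: norm_mult intro: mult_left_mono norm_le_block_norm)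
  then have "block_norm (\<lambda>i. c * x i) n powr p \<le> norm c powr p * block_norm x n powr p" for n
    using powr_mono2[of p "block_norm (\<lambda>i. c * x i) n" "norm c * block_norm x n"] p by (simp add: powr_mult)
  then have "summable (\<lambda>n. block_norm (\<lambda>i. c * x i) n powr p)"
    by (intro summable_comparison_test'[OF summable_mult[OF sx, of "norm c powr p"]]) auto
  then show "(\<lambda>i. c * x i) \<in> lp_sum_linf_space p"
    using x by (simp add: lp_sum_linf_space_def)
  show "y \<in> lp_sum_linf_space p" if "\<forall>i. norm (y i) = norm (x i)"
  proof -
    have "block_norm y n = block_norm x n" for n using that by (simp add: block_norm_def)
    moreover have "y (i, n) = 0" if "n < i" for i n
    proof -
      have "x (i, n) = 0" using x that by (simp add: lp_sum_linf_space_def)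
      then show ?thesis using \<open>\<forall>i. norm (y i) = norm (x i)\<close> by (metis norm_eq_zero)
    qed
    ultimately show ?thesis using x by (simp add: lp_sum_linf_space_def)
  qed
  assume y: "y \<in> lp_sum_linf_space p"
  then have sy: "summable (\<lambda>n. block_norm y n powr p)" by (simp add: lp_sum_linf_space_def)
  have le: "block_norm (\<lambda>i. x i + y i) n \<le> block_norm x n + block_norm y n" for n
    by (rule block_norm_leI) (auto intro: norm_triangle_le add_mono norm_le_block_norm)
  have "block_norm (\<lambda>i. x i + y i) n powr p \<le> 2 powr p * (block_norm x n powr p + block_norm y n powr p)" for n
    by (rule order_trans[OF powr_mono2[OF _ block_norm_nonneg le] powr_add_le]) (use p in auto)
  then have "summable (\<lambda>n. block_norm (\<lambda>i. x i + y i) n powr p)"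
    by (intro summable_comparison_test'[OF summable_mult[OF summable_add[OF sx sy], of "2 powr p"]]) auto
  then show "(\<lambda>i. x i + y i) \<in> lp_sum_linf_space p"
    using x y by (simp add: lp_sum_linf_space_def)
qed auto

section \<open>Lengths that grow fast enough\<close>

lemma sum_lessThan_add:
  fixes a b :: nat and w :: "nat \<Rightarrow> real"
  shows "(\<Sum>j<a + b. w j) = (\<Sum>j<a. w j) + (\<Sum>j<b. w (a + j))"
  by (induction b) auto

lemma sum_antimono_le_initial:
  fixes w :: "nat \<Rightarrow> real"
  assumes w: "decseq w" and "finite B"
  shows "sum w B \<le> (\<Sum>j<card B. w j)"
  using \<open>finite B\<close>
proof (induction "card B" arbitrary: B)
  case (Suc n)
  then have ne: "B \<noteq> {}" by auto
  let ?b = "Max B"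
  have b: "?b \<in> B" using Suc ne by simp
  have c: "card (B - {?b}) = n" using Suc b by simp
  have "B - {?b} \<subseteq> {..<?b}" using Suc(3) by (auto simp: less_le)
  then have "n \<le> ?b" using card_mono[of "{..<?b}" "B - {?b}"] c by simp
  then have "w ?b \<le> w n" using w by (auto simp: decseq_def)
  moreover have "sum w (B - {?b}) \<le> (\<Sum>j<n. w j)" using Suc(1)[of "B - {?b}"] c Suc(3) by simp
  ultimately show ?case using Suc(2)[symmetric] sum.remove[OF Suc(3) b, of w] by simp
qed simp

text \<open>
  The \<open>m\<close>-th interval in the order of choice has length \<open>len m\<close>, and \<open>M m\<close> is a scale exceeding all
  that was chosen before. The first \<open>M m\<close> weights are negligible against the mass that the interval
  collects from the weights starting at \<open>M m\<close>, and so is anything that the interval can collect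
  from weights beyond \<open>M (Suc m)\<close>. Since \<open>M 0\<close> is positive, so are all these masses. As block \<open>n\<close> uses only indices \<open>m \<ge> n\<close>, the tolerance \<open>\<epsilon> / Suc m\<close>
  sums to at most \<open>\<epsilon>\<close> over its \<open>n + 1\<close> intervals.
\<close>

locale garling_blocks =
  fixes p \<epsilon> :: real and w :: "nat \<Rightarrow> real" and M len :: "nat \<Rightarrow> nat"
  assumes p: "1 \<le> p" and eps: "0 < \<epsilon>" and w: "w \<in> weights"
    and M0: "1 \<le> M 0"
    and M_Suc: "M m + len m \<le> M (Suc m)"
    and weight_before: "(\<Sum>j<M m. w j) \<le> \<epsilon> / Suc m * (\<Sum>j<len m. w (M m + j))"
    and weight_beyond: "len m * w (M (Suc m)) \<le> \<epsilon> / Suc m * (\<Sum>j<len m. w (M m + j))"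

text \<open>
  For a given \<open>M m\<close>, the length is chosen by divergence of the series of weights, and then
  \<open>M (Suc m)\<close> by convergence of the weights to \<open>0\<close>.
\<close>

lemma garling_blocks_exist:
  assumes p: "1 \<le> p" and eps: "0 < \<epsilon>" and w: "w \<in> weights"
  shows "\<exists>M len. garling_blocks p \<epsilon> w M len"
proof -
  have wp: "w j > 0" and lim: "w \<longlonglongrightarrow> 0" and ns: "\<not> summable w" for j
    using w by (auto simp: weights_def)
  have step: "\<exists>M' l. m + l \<le> M' \<and> (\<Sum>j<m. w j) \<le> d * (\<Sum>j<l. w (m + j)) \<and>
      l * w M' \<le> d * (\<Sum>j<l. w (m + j))" if "0 < d" for d :: real and m :: nat
  proof -
    have "\<not> summable (\<lambda>j. w (j + m))" using ns summable_iff_shift[of w m] by simp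
    then have "\<exists>l. \<not> (\<Sum>j<l. w (j + m)) \<le> (1 + (\<Sum>j<m. w j)) / d"
      using wp summableI_nonneg_bounded[of "\<lambda>j. w (j + m)"] by (metis less_imp_le)
    then obtain l where l: "(\<Sum>j<l. w (m + j)) > (1 + (\<Sum>j<m. w j)) / d"
      by (auto simp: not_le add.commute)
    then have l': "1 + (\<Sum>j<m. w j) < d * (\<Sum>j<l. w (m + j))"
      using that by (simp add: divide_less_eq mult.commute)
    have "(\<lambda>k. real l * w k) \<longlonglongrightarrow> real l * 0" by (intro tendsto_intros lim)
    then have "eventually (\<lambda>k. l * w k < 1) sequentially"
      by (rule order_tendstoD) simp
    then obtain K where K: "\<And>k. k \<ge> K \<Longrightarrow> l * w k < 1" by (auto simp: eventually_sequentially)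
    have s0: "0 \<le> (\<Sum>j<m. w j)" using wp by (intro sum_nonneg) (auto intro: less_imp_le)
    show ?thesis
      by (rule exI[of _ "max K (m + l)"], rule exI[of _ l]) (use l' s0 K[of "max K (m + l)"] in auto)
  qed
  define Q where "Q m a b l \<longleftrightarrow> a + l \<le> b \<and> (\<Sum>j<a. w j) \<le> \<epsilon> / Suc m * (\<Sum>j<l. w (a + j)) \<and>
      l * w b \<le> \<epsilon> / Suc m * (\<Sum>j<l. w (a + j))" for m a b l
  have "\<exists>M. \<forall>m. 1 \<le> M m \<and> (\<exists>l. Q m (M m) (M (Suc m)) l)"
  proof (rule dependent_nat_choice)
    show "\<exists>x::nat. 1 \<le> x" by auto
  next
    fix a m :: nat assume a: "1 \<le> a"
    have "0 < \<epsilon> / Suc m" using eps by simp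
    from step[OF this, of a] obtain b l where "Q m a b l" unfolding Q_def by blast
    with a show "\<exists>b. 1 \<le> b \<and> (\<exists>l. Q m a b l)" unfolding Q_def by (meson add_leD1 le_trans)
  qed
  then obtain M where M: "\<And>m. 1 \<le> M m" "\<And>m. \<exists>l. Q m (M m) (M (Suc m)) l" by blast
  then obtain len where "\<And>m. Q m (M m) (M (Suc m)) (len m)" by metis
  then have "garling_blocks p \<epsilon> w M len"
    using M(1) assms by unfold_locales (auto simp: Q_def)
  then show ?thesis by blast
qed

context garling_blocks
begin

text \<open>
  The order of choice: block by block, and by increasing \<open>i\<close> inside a block.
\<close>

definition ix :: "nat \<times> nat \<Rightarrow> nat" where
  "ix q = triangle (snd q) + fst q"

definition mass :: "nat \<times> nat \<Rightarrow> real" where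
  "mass q = (\<Sum>j<len (ix q). w (M (ix q) + j))"

text \<open>
  Block \<open>n\<close> occupies the range from \<open>M (triangle n)\<close> to \<open>M (triangle (Suc n))\<close>. The slots
  \<open>[M m, M (Suc m))\<close> with \<open>m = ix (i, n)\<close> partition this range, and reflecting them in its midpoint
  puts the longer intervals, which are chosen later, to the left.
\<close>

definition start :: "nat \<times> nat \<Rightarrow> nat" where
  "start q = M (triangle (snd q)) + M (triangle (Suc (snd q))) - M (Suc (ix q))"

definition intv :: "nat \<times> nat \<Rightarrow> nat set" where
  "intv q = {start q..<start q + len (ix q)}"

lemma w_pos: "0 < w j" and w_nonneg: "0 \<le> w j" and w_dec: "i \<le> j \<Longrightarrow> w j \<le> w i"
  using w by (auto simp: weights_def less_imp_le decseq_def)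

lemma M_mono: "m \<le> m' \<Longrightarrow> M m \<le> M m'"
  by (rule lift_Suc_mono_le[of M]) (rule add_leD1[OF M_Suc])

lemma weight_before_pos: "0 < (\<Sum>j<M m. w j)"
proof -
  have "0 < M m" using M0 M_mono[of 0 m] by simp
  then show ?thesis using w_pos by (intro sum_pos) auto
qed

lemma mass_pos: "0 < mass q"
proof -
  have "0 < \<epsilon> / Suc (ix q) * mass q"
    using weight_before_pos[of "ix q"] weight_before[of "ix q"] by (simp add: mass_def)
  then show ?thesis using eps by (simp add: zero_less_mult_iff zero_less_divide_iff)
qed

lemma triangle_ge: "n \<le> triangle n"
  by (induction n) auto

lemma start_bounds:
  assumes "i \<le> n"
  shows "M (triangle n) \<le> start (i, n)" and "start (i, n) + len (ix (i, n)) \<le> M (triangle (Suc n))"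
    and "start (i, n) + M (Suc (ix (i, n))) = M (triangle n) + M (triangle (Suc n))"
proof -
  have 1: "M (triangle n) \<le> M (ix (i, n))" "M (Suc (ix (i, n))) \<le> M (triangle (Suc n))"
    using assms by (auto intro!: M_mono simp: ix_def)
  show "M (triangle n) \<le> start (i, n)"
    using 1 by (simp add: start_def)
  show e: "start (i, n) + M (Suc (ix (i, n))) = M (triangle n) + M (triangle (Suc n))"
    using 1 by (simp add: start_def)
  show "start (i, n) + len (ix (i, n)) \<le> M (triangle (Suc n))"
    using 1 M_Suc[of "ix (i, n)"] e by linarith
qed

lemma intv_less_same_block:
  assumes "i < i'" "i' \<le> n" "k \<in> intv (i, n)" "k' \<in> intv (i', n)"
  shows "k' < k"
proof -
  have "M (Suc (ix (i, n))) \<le> M (ix (i', n))" using assms by (intro M_mono) (auto simp: ix_def)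
  then show ?thesis
    using start_bounds(3)[of i n] start_bounds(3)[of i' n] M_Suc[of "ix (i', n)"] assms
    by (auto simp: intv_def)
qed

lemma intv_less_other_block:
  assumes "n < n'" "i \<le> n" "i' \<le> n'" "k \<in> intv (i, n)" "k' \<in> intv (i', n')"
  shows "k < k'"
proof -
  have "triangle (Suc n) \<le> triangle n'"
    using \<open>n < n'\<close> lift_Suc_mono_le[of triangle "Suc n" n'] by auto
  then have "M (triangle (Suc n)) \<le> M (triangle n')" by (rule M_mono)
  then show ?thesis
    using start_bounds(2)[of i n] start_bounds(1)[of i' n'] assms by (auto simp: intv_def)
qed

lemma intv_eq:
  assumes "fst q \<le> snd q" "fst q' \<le> snd q'" "k \<in> intv q" "k \<in> intv q'"
  shows "q = q'"
proof -
  obtain i n i' n' where q: "q = (i, n)" "q' = (i', n')" by (cases q, cases q') auto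
  have "n = n'"
    using intv_less_other_block[of n n' i i' k k] intv_less_other_block[of n' n i' i k k] assms q
    by (metis fst_conv snd_conv less_irrefl nat_neq_iff)
  moreover from this have "i = i'"
    using intv_less_same_block[of i i' n k k] intv_less_same_block[of i' i n k k] assms q
    by (metis fst_conv snd_conv less_irrefl nat_neq_iff)
  ultimately show ?thesis by (simp add: q)
qed


section \<open>The upper estimate within a block\<close>

text \<open>
  The upper \<open>\<ell>\<^sub>\<infinity>\<close>-estimate in block \<open>n\<close>. Let \<open>l\<close> be the least \<open>i\<close> whose interval the subsequence
  enters at an index below \<open>M (Suc (ix (i, n)))\<close>. The intervals with \<open>i < l\<close> are entered late and
  collect almost nothing. Those with \<open>i > l\<close> lie to the left of \<open>intv (l, n)\<close>, so that they receive only
  weights of index below \<open>M (Suc (ix (l, n)))\<close>, a negligible part of their mass. Only \<open>intv (l, n)\<close> may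
  collect its full mass, exceeded by at most the first \<open>M (ix (l, n))\<close> weights.
\<close>

lemma block_weight_le:
  fixes \<phi> :: "nat \<Rightarrow> nat"
  assumes phi: "strict_mono \<phi>"
  shows "(\<Sum>i\<le>n. (\<Sum>j | j < J \<and> \<phi> j \<in> intv (i, n). w j) / mass (i, n)) \<le> 1 + \<epsilon>"
proof -
  define B where "B i = {j. j < J \<and> \<phi> j \<in> intv (i, n)}" for i
  define \<delta> where "\<delta> = \<epsilon> / Suc n"
  define m where "m i = ix (i, n)" for i
  have fin: "finite (B i)" for i by (simp add: B_def)
  have inj: "inj \<phi>" using phi by (rule strict_mono_imp_inj_on)
  \<comment> \<open>Here the slack in \<open>\<epsilon> / Suc m\<close> is spent: \<open>n \<le> triangle n \<le> ix (i, n)\<close>.\<close>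
  have dm: "\<epsilon> / Suc (m i) \<le> \<delta>" if "i \<le> n" for i
    unfolding \<delta>_def using eps triangle_ge[of n] by (intro divide_left_mono) (auto simp: m_def ix_def)
  have dmass: "x / mass (i, n) \<le> \<delta>" if "i \<le> n" "x \<le> \<epsilon> / Suc (m i) * mass (i, n)" for x i
  proof -
    have "x / mass (i, n) \<le> \<epsilon> / Suc (m i)"
      using that(2) mass_pos[of "(i, n)"] by (subst pos_divide_le_eq) auto
    then show ?thesis using dm[OF that(1)] by linarith
  qed
  have card: "card (B i) \<le> len (m i)" for i
  proof -
    have "card (B i) \<le> card (intv (i, n))"
      using inj by (intro card_inj_on_le[of \<phi>]) (auto simp: B_def intv_def intro: inj_on_subset)
    then show ?thesis by (simp add: intv_def m_def)
  qed
  have order: "j < j'" if "i < i'" "i' \<le> n" "j \<in> B i'" "j' \<in> B i" for i i' j j'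
    using intv_less_same_block[OF that(1,2), of "\<phi> j'" "\<phi> j"] that(3,4) strict_mono_less[OF phi]
    by (auto simp: B_def)
  have initial: "sum w A \<le> (\<Sum>j<k. w j)" if "A \<subseteq> {..<k}" for A k
    using that w_nonneg by (intro sum_mono2) auto
  have whole: "sum w (B i) / mass (i, n) \<le> 1 + \<delta>" if "i \<le> n" for i
  proof -
    have "sum w (B i) \<le> (\<Sum>j<card (B i). w j)"
      using w fin by (intro sum_antimono_le_initial) (auto simp: weights_def)
    also have "\<dots> \<le> (\<Sum>j<M (m i) + len (m i). w j)"
      using card[of i] by (intro initial) auto
    also have "\<dots> = (\<Sum>j<M (m i). w j) + mass (i, n)"
      by (simp add: mass_def m_def sum_lessThan_add)
    finally have "sum w (B i) / mass (i, n) \<le> (\<Sum>j<M (m i). w j) / mass (i, n) + 1"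
      using mass_pos[of "(i, n)"] by (simp add: divide_simps)
    moreover have "(\<Sum>j<M (m i). w j) / mass (i, n) \<le> \<delta>"
      using that by (rule dmass) (use weight_before[of "m i"] in \<open>simp add: mass_def m_def\<close>)
    ultimately show ?thesis by linarith
  qed
  have late: "sum w (B i) / mass (i, n) \<le> \<delta>"
    if "i \<le> n" "\<And>j. j \<in> B i \<Longrightarrow> M (Suc (m i)) \<le> j" for i
  proof (rule dmass)
    have "sum w (B i) \<le> card (B i) * w (M (Suc (m i)))"
      using that(2) w_dec by (intro sum_bounded_above) auto
    also have "\<dots> \<le> len (m i) * w (M (Suc (m i)))"
      using card[of i] w_nonneg by (intro mult_right_mono) auto
    also have "\<dots> \<le> \<epsilon> / Suc (m i) * mass (i, n)" using weight_beyond[of "m i"] by (simp add: mass_def m_def)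
    finally show "sum w (B i) \<le> \<epsilon> / Suc (m i) * mass (i, n)" .
  qed (fact that)
  have early: "sum w (B i) / mass (i, n) \<le> \<delta>"
    if "i \<le> n" "l < i" "j' \<in> B l" "j' < M (Suc (m l))" for i l j'
  proof (rule dmass)
    have "M (Suc (m l)) \<le> M (m i)" using that by (intro M_mono) (auto simp: m_def ix_def)
    then have "sum w (B i) \<le> (\<Sum>j<M (m i). w j)"
      using order[OF that(2,1) _ that(3)] that(4) by (intro initial) fastforce
    also have "\<dots> \<le> \<epsilon> / Suc (m i) * mass (i, n)" using weight_before[of "m i"] by (simp add: mass_def m_def)
    finally show "sum w (B i) \<le> \<epsilon> / Suc (m i) * mass (i, n)" .
  qed (fact that)
  have "\<exists>l\<le>n. \<forall>i\<le>n. i \<noteq> l \<longrightarrow> sum w (B i) / mass (i, n) \<le> \<delta>"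
  proof (cases "\<exists>l. l \<le> n \<and> (\<exists>j\<in>B l. j < M (Suc (m l)))")
    case False
    have "sum w (B i) / mass (i, n) \<le> \<delta>" if "i \<le> n" for i
      by (rule late[OF that]) (use False that in \<open>force simp: not_less\<close>)
    then show ?thesis by blast
  next
    case True
    define l where "l = (LEAST l. l \<le> n \<and> (\<exists>j\<in>B l. j < M (Suc (m l))))"
    have l: "l \<le> n" "\<exists>j\<in>B l. j < M (Suc (m l))" using LeastI_ex[OF True] by (auto simp: l_def)
    have nl: "M (Suc (m i)) \<le> j" if "i < l" "j \<in> B i" for i j
    proof (rule ccontr)
      assume "\<not> M (Suc (m i)) \<le> j"
      then have "i \<le> n \<and> (\<exists>j\<in>B i. j < M (Suc (m i)))" using that l(1) by (auto simp: not_le)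
      then have "l \<le> i" unfolding l_def by (rule Least_le)
      then show False using that by simp
    qed
    have "sum w (B i) / mass (i, n) \<le> \<delta>" if "i \<le> n" "i \<noteq> l" for i
    proof (cases "i < l")
      case True
      then show ?thesis using late[OF that(1)] nl by blast
    next
      case False
      then have "l < i" using that by simp
      then show ?thesis using early[OF that(1)] l(2) by blast
    qed
    then show ?thesis using l(1) by blast
  qed
  then obtain l where l: "l \<le> n" "\<And>i. i \<le> n \<Longrightarrow> i \<noteq> l \<Longrightarrow> sum w (B i) / mass (i, n) \<le> \<delta>" by blast
  have "(\<Sum>i\<le>n. sum w (B i) / mass (i, n)) \<le> (\<Sum>i\<le>n. \<delta> + (if i = l then 1 else 0))"
    using l whole by (intro sum_mono) (auto simp: add.commute)
  also have "\<dots> = 1 + \<epsilon>"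
    using l(1) by (simp add: sum.distrib sum.delta \<delta>_def)
  finally show ?thesis by (simp add: B_def)
qed


section \<open>Synthesis and analysis\<close>

definition covered :: "nat \<Rightarrow> bool" where
  "covered k \<longleftrightarrow> (\<exists>q. fst q \<le> snd q \<and> k \<in> intv q)"

text \<open>
  Off the intervals this is an arbitrary coordinate, and \<open>height\<close> vanishes.
\<close>

definition owner :: "nat \<Rightarrow> nat \<times> nat" where
  "owner k = (SOME q. fst q \<le> snd q \<and> k \<in> intv q)"

text \<open>
  The height of the indicator of \<open>intv q\<close> is chosen such that its \<open>p\<close>-th power times \<open>mass q\<close> is \<open>1\<close>.
\<close>

definition height :: "nat \<Rightarrow> real" where
  "height k = (if covered k then mass (owner k) powr (- 1 / p) else 0)"

definition synthesis :: "(nat \<times> nat \<Rightarrow> 'a::real_or_complex) \<Rightarrow> nat \<Rightarrow> 'a" where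
  "synthesis x k = of_real (height k) * x (owner k)"

definition wt :: "nat \<times> nat \<Rightarrow> nat \<Rightarrow> real" where
  "wt q k = w (M (ix q) + (k - start q))"

text \<open>
  The average of \<open>f\<close> over \<open>intv q\<close> with weights \<open>wt q\<close>, divided by the height of the normalized
  indicator of \<open>intv q\<close>; both factors are combined into one power of the mass.
\<close>

definition analysis :: "(nat \<Rightarrow> 'a::real_or_complex) \<Rightarrow> nat \<times> nat \<Rightarrow> 'a" where
  "analysis f q = (if fst q \<le> snd q
     then of_real (mass q powr (1 / p - 1)) * (\<Sum>k\<in>intv q. of_real (wt q k) * f k) else 0)"

lemma height_nonneg: "0 \<le> height k"
  by (simp add: height_def)

lemma wt_nonneg: "0 \<le> wt q k"
  by (simp add: wt_def w_nonneg)

lemma owner_eq: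
  assumes "fst q \<le> snd q" "k \<in> intv q"
  shows "owner k = q"
  unfolding owner_def 
proof (rule some_equality)
  show "q' = q" if "fst q' \<le> snd q' \<and> k \<in> intv q'" for q'
    using intv_eq[of q' q k] that assms by blast
qed (use assms in blast)

lemma owner_covered: "covered k \<Longrightarrow> fst (owner k) \<le> snd (owner k) \<and> k \<in> intv (owner k)"
  unfolding covered_def owner_def by (rule someI_ex)

lemma sum_wt: "(\<Sum>k\<in>intv q. wt q k) = mass q"
  unfolding intv_def mass_def wt_def
  by (rule sum.reindex_bij_witness[of _ "\<lambda>j. start q + j" "\<lambda>k. k - start q"]) auto

lemma analysis_synthesis:
  assumes "x \<in> lp_sum_linf_space p"
  shows "analysis (synthesis x) = x"
proof
  fix q
  show "analysis (synthesis x) q = x q"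
  proof (cases "fst q \<le> snd q")
    case False
    then show ?thesis using assms by (cases q) (auto simp: analysis_def lp_sum_linf_space_def)
  next
    case True
    have "synthesis x k = of_real (mass q powr (- 1 / p)) * x q" if "k \<in> intv q" for k
    proof -
      have "covered k" unfolding covered_def using True that by blast
      then show ?thesis using owner_eq[OF True that] by (simp add: synthesis_def height_def)
    qed
    then have "(\<Sum>k\<in>intv q. of_real (wt q k) * synthesis x k) =
        (\<Sum>k\<in>intv q. of_real (wt q k)) * (of_real (mass q powr (- 1 / p)) * x q)"
      by (simp add: sum_distrib_right)
    also have "(\<Sum>k\<in>intv q. of_real (wt q k)) = (of_real (mass q) :: 'a)"
      by (simp add: sum_wt flip: of_real_sum)
    finally have "analysis (synthesis x) q =
        of_real (mass q powr (1 / p - 1) * (mass q * mass q powr (- 1 / p))) * x q"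
      using True by (simp add: analysis_def mult.assoc)
    also have "mass q * mass q powr (- 1 / p) = mass q powr (1 - 1 / p)"
      using mass_pos[of q] by (simp add: powr_mult_base)
    also have "mass q powr (1 / p - 1) * mass q powr (1 - 1 / p) = 1"
      using mass_pos[of q] by (simp flip: powr_add)
    finally show ?thesis by simp
  qed
qed

lemma norm_analysis_powr_le:
  assumes q: "fst q \<le> snd q"
  shows "norm (analysis f q) powr p \<le> (\<Sum>k\<in>intv q. norm (f k) powr p * wt q k)"
proof -
  have mp: "0 < mass q" by (rule mass_pos)
  let ?a = "\<lambda>k. wt q k / mass q"
  let ?s = "\<Sum>k\<in>intv q. ?a k * norm (f k)"
  have fin: "finite (intv q)" by (simp add: intv_def)
  have "norm (\<Sum>k\<in>intv q. of_real (wt q k) * f k) \<le> (\<Sum>k\<in>intv q. wt q k * norm (f k))"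
    by (rule order_trans[OF norm_sum]) (simp add: norm_mult wt_nonneg)
  then have "norm (analysis f q) \<le> mass q powr (1 / p - 1) * (\<Sum>k\<in>intv q. wt q k * norm (f k))"
    using q by (simp add: analysis_def norm_mult mult_left_mono)
  also have "\<dots> = mass q powr (1 / p) * ?s"
    using mp by (simp add: powr_diff flip: sum_divide_distrib)
  finally have "norm (analysis f q) powr p \<le> (mass q powr (1 / p) * ?s) powr p"
    using p by (intro powr_mono2) auto
  also have "\<dots> = mass q * ?s powr p"
    using mp p wt_nonneg by (simp add: powr_mult powr_powr sum_nonneg)
  also have "?s powr p \<le> (\<Sum>k\<in>intv q. ?a k * norm (f k) powr p)"
    using mp wt_nonneg p fin
    by (intro powr_convex_sum) (auto simp: sum_wt simp flip: sum_divide_distrib)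
  also have "mass q * (\<Sum>k\<in>intv q. ?a k * norm (f k) powr p) = (\<Sum>k\<in>intv q. norm (f k) powr p * wt q k)"
    using mp by (simp add: sum_distrib_left mult.commute)
  finally show ?thesis using mp by simp
qed

text \<open>
  Select in each block the interval where the coordinate is largest. In the union \<open>B\<close> of these
  intervals, an element of \<open>intv q\<close> at distance \<open>j\<close> from the left end has rank at most
  \<open>M (ix q) + j\<close>, since all earlier blocks lie below \<open>M (ix q)\<close>; hence it meets at least the weight
  that the average gives to it.
\<close>

lemma sum_block_norm_analysis_le:
  assumes f: "f \<in> garling_space w p"
  shows "(\<Sum>n<N. block_norm (analysis f) n powr p) \<le> garling_norm w p f powr p"
proof -
  obtain c where c: "\<And>n. c n \<le> n" "\<And>n. block_norm (analysis f) n = norm (analysis f (c n, n))"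
    using block_norm_attained[where x = "analysis f"] by metis
  define I where "I n = intv (c n, n)" for n
  define B where "B = (\<Union>n<N. I n)"
  define r where "r k = M (ix (owner k)) + (k - start (owner k))" for k
  have fin: "finite (I n)" for n by (simp add: I_def intv_def)
  have owner: "owner k = (c n, n)" if "k \<in> I n" for k n
    using that c(1) by (intro owner_eq) (auto simp: I_def)
  have rank: "card {x\<in>B. x < k} \<le> r k" if k: "k \<in> I n" for k n
  proof -
    have "{x\<in>B. x < k} \<subseteq> {..<M (triangle n)} \<union> {start (c n, n)..<k}"
    proof
      fix x assume "x \<in> {x\<in>B. x < k}"
      then obtain n' where x: "x < k" "x \<in> I n'" by (auto simp: B_def)
      consider "n' < n" | "n' = n" | "n < n'" by linarith
      then show "x \<in> {..<M (triangle n)} \<union> {start (c n, n)..<k}"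
      proof cases
        case 1
        then have "triangle (Suc n') \<le> triangle n"
          using lift_Suc_mono_le[of triangle "Suc n'" n] by auto
        then have "M (triangle (Suc n')) \<le> M (triangle n)" by (rule M_mono)
        then show ?thesis using x start_bounds(2)[OF c(1), of n'] by (auto simp: I_def intv_def)
      next
        case 2
        then show ?thesis using x by (auto simp: I_def intv_def)
      next
        case 3
        then show ?thesis
          using intv_less_other_block[of n n' "c n" "c n'" k x] c(1) x k by (auto simp: I_def)
      qed
    qed
    then have "card {x\<in>B. x < k} \<le> card ({..<M (triangle n)} \<union> {start (c n, n)..<k})"
      by (intro card_mono) auto
    also have "\<dots> \<le> M (triangle n) + (k - start (c n, n))"
      by (rule order_trans[OF card_Un_le]) simp
    also have "\<dots> \<le> r k" using M_mono[of "triangle n" "ix (c n, n)"] owner[OF k] by (simp add: r_def ix_def)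
    finally show ?thesis .
  qed
  have "(\<Sum>n<N. block_norm (analysis f) n powr p) \<le> (\<Sum>n<N. \<Sum>k\<in>I n. norm (f k) powr p * w (r k))"
  proof (rule sum_mono)
    fix n
    have "block_norm (analysis f) n powr p \<le> (\<Sum>k\<in>I n. norm (f k) powr p * wt (c n, n) k)"
      using norm_analysis_powr_le[of "(c n, n)" f] c by (simp add: I_def)
    also have "\<dots> = (\<Sum>k\<in>I n. norm (f k) powr p * w (r k))"
      by (intro sum.cong) (auto simp: wt_def r_def owner)
    finally show "block_norm (analysis f) n powr p \<le> \<dots>" .
  qed
  also have "\<dots> = (\<Sum>k\<in>B. norm (f k) powr p * w (r k))"
  proof -
    have "I m \<inter> I n = {}" if "m \<noteq> n" for m n using owner[of _ m] owner[of _ n] that by (metis disjoint_iff snd_conv)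
    then show ?thesis unfolding B_def using fin by (intro sum.UNION_disjoint[symmetric]) auto
  qed
  also have "\<dots> \<le> garling_norm w p f powr p"
  proof (rule garling_rank_sum_le[OF p w f])
    show "finite B" using fin by (simp add: B_def)
    show "card {x\<in>B. x < k} \<le> r k" if "k \<in> B" for k
      using that rank by (auto simp: B_def)
  qed
  finally show ?thesis .
qed

lemma analysis_contractive:
  assumes f: "f \<in> garling_space w p"
  shows "analysis f \<in> lp_sum_linf_space p" and "lp_sum_linf_norm p (analysis f) \<le> garling_norm w p f"
proof -
  have s: "summable (\<lambda>n. block_norm (analysis f) n powr p)"
    by (rule summableI_nonneg_bounded[OF _ sum_block_norm_analysis_le[OF f]]) simp
  then show "analysis f \<in> lp_sum_linf_space p"
    by (simp add: lp_sum_linf_space_def analysis_def[of f])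
  have "(\<Sum>n. block_norm (analysis f) n powr p) \<le> garling_norm w p f powr p"
    by (rule suminf_le_const[OF s sum_block_norm_analysis_le[OF f]])
  then have "lp_sum_linf_norm p (analysis f) \<le> (garling_norm w p f powr p) powr (1 / p)"
    unfolding lp_sum_linf_norm_def using p s by (intro powr_mono2 suminf_nonneg) auto
  then show "lp_sum_linf_norm p (analysis f) \<le> garling_norm w p f"
    using p garling_norm_nonneg[OF f] by (simp add: powr_powr)
qed

text \<open>
  At most one of the terms on the right is nonzero. Writing a single value as a sum lets the sum
  over a subsequence be exchanged with the sum over the blocks.
\<close>

lemma norm_synthesis_powr_le:
  assumes n: "covered k \<Longrightarrow> snd (owner k) < N"
  shows "norm (synthesis x k) powr p \<le>
    (\<Sum>n<N. block_norm x n powr p * (\<Sum>i\<le>n. (if k \<in> intv (i, n) then 1 / mass (i, n) else 0)))"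
    (is "_ \<le> (\<Sum>n<N. ?g n)")
proof (cases "covered k")
  case False
  then show ?thesis
    by (auto simp: synthesis_def height_def less_imp_le[OF mass_pos] intro!: sum_nonneg mult_nonneg_nonneg)
next
  case True
  obtain i n where q: "owner k = (i, n)" by (cases "owner k")
  have i: "i \<le> n" "k \<in> intv (i, n)" using owner_covered[OF True] q by auto
  have mp: "0 < mass q" for q by (rule mass_pos)
  have "norm (synthesis x k) powr p = (mass (i, n) powr (- 1 / p)) powr p * norm (x (i, n)) powr p"
    using True q by (simp add: synthesis_def height_def norm_mult powr_mult)
  also have "(mass (i, n) powr (- 1 / p)) powr p = 1 / mass (i, n)"
    using p less_imp_le[OF mp[of "(i, n)"]] by (subst powr_powr) (simp add: powr_minus_divide)
  also have "1 / mass (i, n) * norm (x (i, n)) powr p \<le> 1 / mass (i, n) * block_norm x n powr p"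
    using i p mp[of "(i, n)"] by (intro mult_left_mono powr_mono2 norm_le_block_norm) auto
  also have "\<dots> = block_norm x n powr p * (if k \<in> intv (i, n) then 1 / mass (i, n) else 0)"
    using i by simp
  also have "\<dots> \<le> ?g n"
    using i mp by (intro mult_left_mono member_le_sum) (auto intro: less_imp_le)
  also have "\<dots> \<le> (\<Sum>n<N. ?g n)"
    using n[OF True] q mp
    by (intro member_le_sum) (auto simp: less_imp_le[OF mp] intro!: mult_nonneg_nonneg sum_nonneg)
  finally show ?thesis .
qed

lemma synthesis_bounded:
  assumes x: "x \<in> lp_sum_linf_space p"
  shows "synthesis x \<in> garling_space w p" and "garling_norm w p (synthesis x) \<le> (1 + \<epsilon>) * lp_sum_linf_norm p x"
proof -
  let ?b = "\<lambda>n. block_norm x n powr p"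
  have s: "summable ?b" using x by (simp add: lp_sum_linf_space_def)
  have s0: "0 \<le> suminf ?b" using s by (rule suminf_nonneg) simp
  have main: "(\<Sum>j<J. norm (synthesis x (\<phi> j)) powr p * w j) \<le> (1 + \<epsilon>) * suminf ?b"
    if phi: "strict_mono \<phi>" for \<phi> :: "nat \<Rightarrow> nat" and J
  proof -
    \<comment> \<open>A bound for the finitely many blocks that the first \<open>J\<close> terms of the subsequence meet.\<close>
    define N where "N = Suc (\<Sum>j<J. snd (owner (\<phi> j)))"
    have N: "snd (owner (\<phi> j)) < N" if "j < J" for j
      using member_le_sum[of j "{..<J}" "\<lambda>j. snd (owner (\<phi> j))"] that by (simp add: N_def less_Suc_eq_le)
    let ?h = "\<lambda>j n i. (if \<phi> j \<in> intv (i, n) then 1 / mass (i, n) else 0)"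
    have "(\<Sum>j<J. norm (synthesis x (\<phi> j)) powr p * w j) \<le> (\<Sum>j<J. (\<Sum>n<N. ?b n * (\<Sum>i\<le>n. ?h j n i)) * w j)"
      using N w_nonneg by (intro sum_mono mult_right_mono norm_synthesis_powr_le) auto
    also have "\<dots> = (\<Sum>j<J. \<Sum>n<N. ?b n * (\<Sum>i\<le>n. ?h j n i * w j))"
      by (simp add: sum_distrib_right mult.assoc)
    also have "\<dots> = (\<Sum>n<N. ?b n * (\<Sum>i\<le>n. \<Sum>j<J. ?h j n i * w j))"
      by (subst sum.swap) (simp add: sum_distrib_left[symmetric] sum.swap[of _ "{..<J}"])
    also have "\<dots> \<le> (\<Sum>n<N. ?b n * (1 + \<epsilon>))"
    proof (intro sum_mono mult_left_mono)
      fix n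
      have "(\<Sum>j<J. ?h j n i * w j) = (\<Sum>j | j < J \<and> \<phi> j \<in> intv (i, n). w j) / mass (i, n)" for i
      proof -
        have "(\<Sum>j<J. ?h j n i * w j) = (\<Sum>j\<in>{..<J}. if \<phi> j \<in> intv (i, n) then w j / mass (i, n) else 0)"
          by (intro sum.cong) auto
        also have "\<dots> = (\<Sum>j\<in>{j\<in>{..<J}. \<phi> j \<in> intv (i, n)}. w j / mass (i, n))"
          by (rule sum.inter_filter[symmetric]) simp
        finally show ?thesis by (simp add: sum_divide_distrib)
      qed
      then show "(\<Sum>i\<le>n. \<Sum>j<J. ?h j n i * w j) \<le> 1 + \<epsilon>" using block_weight_le[OF phi, of J n] by simp
    qed simp
    also have "\<dots> = (1 + \<epsilon>) * (\<Sum>n<N. ?b n)" by (simp add: sum_distrib_left mult.commute)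
    also have "\<dots> \<le> (1 + \<epsilon>) * suminf ?b"
      using eps s by (intro mult_left_mono sum_le_suminf) auto
    finally show ?thesis .
  qed
  have B0: "0 \<le> (1 + \<epsilon>) * suminf ?b" using s0 eps by simp
  have mem: "synthesis x \<in> garling_space w p \<and>
      garling_norm w p (synthesis x) \<le> ((1 + \<epsilon>) * suminf ?b) powr (1 / p)"
    by (rule garling_memI[OF p w B0]) (rule main)
  show "synthesis x \<in> garling_space w p" using mem by blast
  have "garling_norm w p (synthesis x) \<le> (1 + \<epsilon>) powr (1 / p) * lp_sum_linf_norm p x"
    using mem s0 eps by (simp add: lp_sum_linf_norm_def powr_mult)
  also have "(1 + \<epsilon>) powr (1 / p) \<le> (1 + \<epsilon>) powr 1"
    using eps p by (intro powr_mono) auto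
  then have "(1 + \<epsilon>) powr (1 / p) * lp_sum_linf_norm p x \<le> (1 + \<epsilon>) * lp_sum_linf_norm p x"
    using eps by (intro mult_right_mono) (auto simp: lp_sum_linf_norm_def)
  finally show "garling_norm w p (synthesis x) \<le> (1 + \<epsilon>) * lp_sum_linf_norm p x" .
qed

lemma synthesis_linear: "linear_map_on F synthesis"
  by (auto simp: linear_map_on_def synthesis_def algebra_simps)

lemma analysis_linear: "linear_map_on E analysis"
  by (auto simp: linear_map_on_def analysis_def sum.distrib sum_distrib_left algebra_simps fun_eq_iff)

lemma synthesis_modulus: "modulus (synthesis x) = synthesis (modulus x)"
  by (simp add: modulus_def synthesis_def norm_mult height_nonneg fun_eq_iff)

lemma synthesis_conj: "(\<lambda>k. scalar_conj (synthesis x k)) = synthesis (\<lambda>q. scalar_conj (x q))"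
  by (simp add: synthesis_def scalar_conj_of_real_mult fun_eq_iff)

lemma analysis_nonneg:
  assumes "nonneg f"
  shows "nonneg (analysis f)"
  unfolding nonneg_def
proof
  fix q
  obtain g where g: "\<And>k. g k \<ge> 0" "\<And>k. f k = of_real (g k)" using assms unfolding nonneg_def by metis
  show "\<exists>r\<ge>0. analysis f q = of_real r"
  proof (cases "fst q \<le> snd q")
    case True
    then have "analysis f q = of_real (mass q powr (1 / p - 1) * (\<Sum>k\<in>intv q. wt q k * g k))"
      by (simp add: analysis_def g(2))
    then show ?thesis using g(1) wt_nonneg by (metis (no_types, lifting) mult_nonneg_nonneg powr_ge_zero sum_nonneg)
  qed (auto simp: analysis_def intro: exI[of _ 0])
qed

lemma synthesis_nonneg:
  assumes "nonneg x"
  shows "nonneg (synthesis x)"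
  unfolding nonneg_def
proof
  fix k
  obtain r where "r \<ge> 0" "x (owner k) = of_real r" using assms unfolding nonneg_def by metis
  then show "\<exists>r\<ge>0. synthesis x k = of_real r"
    using height_nonneg[of k] by (intro exI[of _ "height k * r"]) (simp add: synthesis_def)
qed

end

theorem theorem2p1:
  fixes p :: real and w :: "nat \<Rightarrow> real" and \<epsilon> :: real
  assumes "1 \<le> p" and "w \<in> weights" and "\<epsilon> > 0"
  shows "\<exists>Z :: (nat \<Rightarrow> 'a::real_or_complex) set.
    sublattice Z (garling_space w p) (garling_norm w p) \<and>
    lattice_complemented (1 + \<epsilon>) Z (garling_space w p) (garling_norm w p) \<and>
    lattice_isomorphic (1 + \<epsilon>) Z (garling_norm w p)
      (lp_sum_linf_space p :: (nat \<times> nat \<Rightarrow> 'a) set) (lp_sum_linf_norm p)"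
proof -
  obtain M len where "garling_blocks p \<epsilon> w M len"
    using garling_blocks_exist[OF assms(1,3,2)] by blast
  then interpret garling_blocks p \<epsilon> w M len .
  show ?thesis
  proof (rule exI, rule factorization_sublattice)
    show "lattice_carrier (garling_space w p :: (nat \<Rightarrow> 'a) set) (garling_norm w p)"
      by (rule lattice_carrier_garling[OF p w])
    show "lattice_carrier (lp_sum_linf_space p :: (nat \<times> nat \<Rightarrow> 'a) set) (lp_sum_linf_norm p)"
      by (rule lattice_carrier_lp_sum[OF p])
    show "linear_map_on (lp_sum_linf_space p) synthesis" by (rule synthesis_linear)
    show "linear_map_on (garling_space w p) analysis" by (rule analysis_linear)
  qed (use eps in \<open>auto intro: norm_le_garling_norm[OF p w] synthesis_bounded analysis_contractive
      analysis_synthesis synthesis_modulus synthesis_conj synthesis_nonneg analysis_nonneg\<close>)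
qed

end
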